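(* Let $S$ be the current set of generated results of a top-$k$ search, let $D_i(S)$ be given for $1\le i\le k$, and let $\overline{u}$ be the score upper bound of all the unseen results. Then an upper bound $\overline{\mathrm{best}}(S)$ for the score of the optimal solution, considering both the current result set $S$ and the unseen results, can be calculated as $$\overline{\mathrm{best}}(S)=\max_{1\le i\le k}\{\mathrm{score}(D_i(S))+(k-i)\times\overline{u}\},$$ where $\overline{u}$ is the score $\mathrm{score}(v)$ of the last generated result $v$ in the incremental framework, and $\overline{u}$ is the maintained upper bound of the scores of the unseen results in the bounding framework.
   Context: Each result $v$ has a score $\mathrm{score}(v)$. Two distinct results $v,w$ are similar, written $v\approx w$, iff $\mathrm{sim}(v,w)>\tau$, where $\mathrm{sim}$ is a user-defined similarity function with values in $[0,1]$ and $0<\tau\le 1$ is a user-defined threshold. For a set $A$ of results, the diversity graph $G(A)$ is the undirected graph with node set $A$ and an edge between two distinct results $v,w$ iff $v\approx w$. For a set $T$ of results, $\mathrm{score}(T)=\sum_{v\in T}\mathrm{score}(v)$. The optimal solution is a set of at most $k$ results (chosen among generated and unseen results), no two of which are similar, with maximum total score. For $1\le i\le k$, $D_i(S)$ is an independent set of $G(S)$ with exactly $i$ elements whose total score is maximum among all such sets; $D_i(S)=\emptyset$ if $G(S)$ has no independent set with $i$ elements. Results are generated one by one; $S$ is the set of those generated so far, and the remaining results are unseen. In the incremental framework results are generated in non-increasing order of score. In the bounding framework results are not necessarily generated in that order, but an upper bound on the scores of the unseen results is maintained and updated after each generated result.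
   Formalization: The formal version assumes the score upper bound of unseen results is nonnegative and, in the bounding framework, that if the optimal solution contains no generated result then some generated result scores at least this bound; the claim fails without either. *)

theory Defs
  imports Complex_Main
begin

definition similar :: "('a \<Rightarrow> 'a \<Rightarrow> real) \<Rightarrow> real \<Rightarrow> 'a \<Rightarrow> 'a \<Rightarrow> bool" where
  "similar sim \<tau> v w \<longleftrightarrow> v \<noteq> w \<and> sim v w > \<tau>"

text \<open>An undirected graph is a pair of a node set and a set of unordered edges.\<close>

type_synonym 'a graph = "'a set \<times> 'a set set"

definition diversity_graph :: "('a \<Rightarrow> 'a \<Rightarrow> real) \<Rightarrow> real \<Rightarrow> 'a set \<Rightarrow> 'a graph" where
  "diversity_graph sim \<tau> A = (A, {{v, w} | v w. v \<in> A \<and> w \<in> A \<and> similar sim \<tau> v w})"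

definition independent_set :: "'a graph \<Rightarrow> 'a set \<Rightarrow> bool" where
  "independent_set G X \<longleftrightarrow> X \<subseteq> fst G \<and> (\<forall>v\<in>X. \<forall>w\<in>X. v \<noteq> w \<longrightarrow> {v, w} \<notin> snd G)"

text \<open>
  \<open>X\<close> is an admissible choice of \<open>D\<^sub>i\<close> for the graph \<open>G\<close>; ties make it non-unique. It is
  used for \<open>i \<ge> 1\<close> only, where \<open>card X = i\<close> entails finiteness.
\<close>

definition max_independent_set :: "('a \<Rightarrow> real) \<Rightarrow> 'a graph \<Rightarrow> nat \<Rightarrow> 'a set \<Rightarrow> bool" where
  "max_independent_set score G i X \<longleftrightarrow>
    (if \<exists>Y. independent_set G Y \<and> card Y = i
     then independent_set G X \<and> card X = i \<and>
       (\<forall>Y. independent_set G Y \<and> card Y = i \<longrightarrow> sum score Y \<le> sum score X)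
     else X = {})"

definition feasible_solution ::
  "('a \<Rightarrow> 'a \<Rightarrow> real) \<Rightarrow> real \<Rightarrow> nat \<Rightarrow> 'a set \<Rightarrow> 'a set \<Rightarrow> bool" where
  "feasible_solution sim \<tau> k R T \<longleftrightarrow>
    T \<subseteq> R \<and> finite T \<and> card T \<le> k \<and> pairwise (\<lambda>v w. \<not> similar sim \<tau> v w) T"

definition optimal_solution ::
  "('a \<Rightarrow> real) \<Rightarrow> ('a \<Rightarrow> 'a \<Rightarrow> real) \<Rightarrow> real \<Rightarrow> nat \<Rightarrow> 'a set \<Rightarrow> 'a set \<Rightarrow> bool" where
  "optimal_solution score sim \<tau> k R T \<longleftrightarrow>
    feasible_solution sim \<tau> k R T \<and>
    (\<forall>T'. feasible_solution sim \<tau> k R T' \<longrightarrow> sum score T' \<le> sum score T)"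

definition best_bound :: "('a \<Rightarrow> real) \<Rightarrow> (nat \<Rightarrow> 'a set) \<Rightarrow> nat \<Rightarrow> real \<Rightarrow> real" where
  "best_bound score D k u = Max ((\<lambda>i. sum score (D i) + real (k - i) * u) ` {1..k})"

text \<open>
  The list \<open>vs\<close> holds the results generated so far in the order of generation and \<open>U\<close> is the set
  of unseen results. As unseen results come after all generated ones, generation in
  non-increasing order of score also puts their scores below those of the generated results.
\<close>

definition incremental_framework ::
  "('a \<Rightarrow> real) \<Rightarrow> 'a list \<Rightarrow> 'a set \<Rightarrow> real \<Rightarrow> bool" where
  "incremental_framework score vs U u \<longleftrightarrow>
    vs \<noteq> [] \<and> sorted_wrt (\<lambda>v w. score v \<ge> score w) vs \<and>
    (\<forall>v\<in>set vs. \<forall>w\<in>U. score v \<ge> score w) \<and> u = score (last vs)"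

definition bounding_framework :: "('a \<Rightarrow> real) \<Rightarrow> 'a set \<Rightarrow> real \<Rightarrow> bool" where
  "bounding_framework score U u \<longleftrightarrow> (\<forall>w\<in>U. score w \<le> u)"

end

theory Submission
  imports Defs
begin

text \<open>
  Split \<open>T\<close> into its generated part, of size \<open>i\<close>, and its unseen part, of size at most \<open>k - i\<close>.
  If \<open>i \<ge> 1\<close> the generated part competes with \<open>D\<^sub>i\<close>, and each unseen result contributes at most
  \<open>u\<close>. If \<open>i = 0\<close> the score of \<open>T\<close> is at most \<open>k u\<close>; as some generated result scores at least
  \<open>u\<close>, so does \<open>D\<^sub>1\<close>, and the term for index 1 suffices.
\<close>

text \<open>An unordered edge \<open>{v, w}\<close> records similarity in either direction; as
  \<open>pairwise\<close> ranges over both orders, the two notions agree even for asymmetric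
  \<open>sim\<close>.\<close>

lemma independent_set_diversity_graph:
  "independent_set (diversity_graph sim \<tau> A) X \<longleftrightarrow>
    X \<subseteq> A \<and> pairwise (\<lambda>v w. \<not> similar sim \<tau> v w) X"
proof -
  have edge: "{v, w} \<in> snd (diversity_graph sim \<tau> A) \<longleftrightarrow>
      v \<in> A \<and> w \<in> A \<and> (similar sim \<tau> v w \<or> similar sim \<tau> w v)" for v w
    by (auto simp: diversity_graph_def doubleton_eq_iff)
  have nodes: "fst (diversity_graph sim \<tau> A) = A"
    by (simp add: diversity_graph_def)
  show ?thesis
    unfolding independent_set_def pairwise_def nodes edge by (metis subsetD)
qed

text \<open>\<open>Y\<close> itself witnesses existence, which rules out the default
  \<open>X = {}\<close>.\<close>

lemma max_independent_set_ge:
  assumes "max_independent_set score G i X" "independent_set G Y" "card Y = i"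
  shows "sum score Y \<le> sum score X"
  using assms unfolding max_independent_set_def by (metis (full_types))

lemma best_bound_ge:
  assumes "1 \<le> i" "i \<le> k"
  shows "sum score (D i) + real (k - i) * u \<le> best_bound score D k u"
  unfolding best_bound_def using assms by (intro Max_ge) auto

lemma bounding_framework_if_incremental:
  "incremental_framework score vs U u \<Longrightarrow> bounding_framework score U u"
  by (auto simp: incremental_framework_def bounding_framework_def)

text \<open>The maximum has no term \<open>k * u\<close> for index 0, so \<open>attained\<close>
  must cover an all-unseen \<open>T\<close>: with \<open>S = {}\<close> the bound is only
  \<open>(k - 1) * u\<close>.\<close>

lemma feasible_solution_le_best_bound:
  fixes u :: real
  assumes k: "1 \<le> k" and u_nonneg: "0 \<le> u"
    and D: "\<And>i. 1 \<le> i \<Longrightarrow> i \<le> k \<Longrightarrow> max_independent_set score (diversity_graph sim \<tau> S) i (D i)"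
    and T: "feasible_solution sim \<tau> k (S \<union> U) T"
    and bounding: "bounding_framework score U u"
    and attained: "T \<inter> S = {} \<Longrightarrow> \<exists>v\<in>S. u \<le> score v"
  shows "sum score T \<le> best_bound score D k u"
proof -
  have fin: "finite T" and card_T: "card T \<le> k" and T_sub: "T \<subseteq> S \<union> U"
    and indep: "pairwise (\<lambda>v w. \<not> similar sim \<tau> v w) T"
    using T by (auto simp: feasible_solution_def)
  have le_D: "sum score Y \<le> sum score (D (card Y))"
    if "Y \<subseteq> S" "pairwise (\<lambda>v w. \<not> similar sim \<tau> v w) Y" "1 \<le> card Y" "card Y \<le> k" for Y
    using max_independent_set_ge[OF D] that by (simp add: independent_set_diversity_graph)
  have unseen: "sum score (T - S) \<le> real (card (T - S)) * u"
    using T_sub bounding by (intro sum_bounded_above) (auto simp: bounding_framework_def)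
  show ?thesis
  proof (cases "T \<inter> S = {}")
    case False
    define i where "i = card (T \<inter> S)"
    have card_split: "card T = i + card (T - S)"
      unfolding i_def using fin by (metis card_Int_Diff)
    have i: "1 \<le> i" "i \<le> k"
      using False fin card_split card_T by (auto simp: i_def Suc_le_eq card_gt_0_iff)
    have "sum score T = sum score (T \<inter> S) + sum score (T - S)"
      using fin by (rule sum.Int_Diff)
    also have "\<dots> \<le> sum score (D i) + real (card (T - S)) * u"
      using le_D[of "T \<inter> S"] indep i unseen unfolding i_def
      by (intro add_mono) (auto intro: pairwise_subset)
    \<comment> \<open>\<open>T\<close> may leave some of the \<open>k\<close> slots empty; charging
      \<open>u\<close> for each of them loses nothing since \<open>0 \<le> u\<close>.\<close>
    also have "\<dots> \<le> sum score (D i) + real (k - i) * u"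
      using card_split card_T u_nonneg by (intro add_left_mono mult_right_mono) auto
    also have "\<dots> \<le> best_bound score D k u"
      using i by (rule best_bound_ge)
    finally show ?thesis .
  next
    case True
    then obtain v where v: "v \<in> S" "u \<le> score v"
      using attained by blast
    have "sum score T \<le> real (card T) * u"
      using unseen True by (simp add: Diff_triv)
    also have "\<dots> \<le> real k * u"
      using card_T u_nonneg by (intro mult_right_mono) auto
    \<comment> \<open>One copy of \<open>u\<close> is split off, to be paid for by \<open>v\<close>:
      the singleton \<open>{v}\<close> is trivially independent and competes with
      \<open>D 1\<close>.\<close>
    also have "\<dots> = u + real (k - 1) * u"
      using k by (simp add: of_nat_diff algebra_simps)
    also have "\<dots> \<le> sum score (D 1) + real (k - 1) * u"
      using le_D[of "{v}"] v k by (simp add: pairwise_def)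
    also have "\<dots> \<le> best_bound score D k u"
      using k by (intro best_bound_ge) auto
    finally show ?thesis .
  qed
qed

theorem lemma1:
  fixes score :: "'a \<Rightarrow> real" and sim :: "'a \<Rightarrow> 'a \<Rightarrow> real" and \<tau> u :: real
    and k :: nat and vs :: "'a list" and S U T :: "'a set" and D :: "nat \<Rightarrow> 'a set"
  assumes sim_range: "\<And>v w. 0 \<le> sim v w \<and> sim v w \<le> 1"
    and threshold: "0 < \<tau>" "\<tau> \<le> 1"
    and k: "1 \<le> k"
    and generated: "distinct vs" "S = set vs"
    and unseen: "S \<inter> U = {}"
    and D: "\<And>i. 1 \<le> i \<Longrightarrow> i \<le> k \<Longrightarrow> max_independent_set score (diversity_graph sim \<tau> S) i (D i)"
    and u_nonneg: "0 \<le> u"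
    and T: "optimal_solution score sim \<tau> k (S \<union> U) T"
  shows "(incremental_framework score vs U u \<longrightarrow> sum score T \<le> best_bound score D k u) \<and>
    (bounding_framework score U u \<and> (T \<inter> S = {} \<longrightarrow> (\<exists>v\<in>S. u \<le> score v)) \<longrightarrow>
      sum score T \<le> best_bound score D k u)"
proof -
  have bound: "sum score T \<le> best_bound score D k u"
    if "bounding_framework score U u" "T \<inter> S = {} \<Longrightarrow> \<exists>v\<in>S. u \<le> score v"
    using T that unfolding optimal_solution_def
    by (intro feasible_solution_le_best_bound[OF k u_nonneg D]) auto
  \<comment> \<open>Here \<open>u\<close> is the score of the last generated result, which is thus
    the required witness in \<open>S\<close>.\<close>
  have "last vs \<in> S \<and> u \<le> score (last vs)" if "incremental_framework score vs U u"
    using that generated by (simp add: incremental_framework_def)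
  then show ?thesis
    using bound bounding_framework_if_incremental by blast
qed

end
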